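(* Let $\mathcal{C}$ be a regular category with a fixed terminal class $\mathcal{Z}$ of zero objects, with coreflector $\mathsf{Z}$. Let $(\mathbb{E},\mathbb{M})$ be a factorization system in $\mathcal{C}$ which is stable with respect to the class of arrows inverted by $\mathsf{Z}$ and such that every arrow in $\mathbb{E}$ is a $\mathcal{Z}$-cokernel. Define full subcategories of $\mathcal{C}$ by $$\mathcal{T}=\{T\in\mathcal{C}\mid \text{there exists an arrow } T\to Z \text{ in } \mathbb{E} \text{ with } Z\in\mathcal{Z}\},\qquad \mathcal{F}=\{F\in\mathcal{C}\mid v_F\colon F\to\mathsf{V}(F)\text{ belongs to }\mathbb{M}\}.$$ Then $(\mathcal{T},\mathcal{F})$ is a $\mathcal{Z}$-torsion theory in $\mathcal{C}$ (in particular $\mathcal{T}\cap\mathcal{F}=\mathcal{Z}$) satisfying Conditions (N) and (M).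
   Context: A class of zero objects in a category $\mathcal{C}$ is a full subcategory $\mathcal{Z}$ (taken closed under isomorphism) which is posetal (at most one morphism between any two of its objects), monocoreflective (the inclusion has a right adjoint $\mathsf{Z}$, the coreflector, with every counit component $\varepsilon_A\colon\mathsf{Z}(A)\to A$ a monomorphism), and such that $\mathsf{Z}(m)$ is an isomorphism for every monomorphism $m$ of $\mathcal{C}$. It is terminal if for every $A\in\mathcal{C}$ there is an arrow $v_A\colon A\to\mathsf{V}(A)$ with $\mathsf{V}(A)\in\mathcal{Z}$ such that for every $\chi\colon A\to Z$ with $Z\in\mathcal{Z}$ there is a (necessarily unique) $\varphi\colon Z\to\mathsf{V}(A)$ with $\varphi\chi=v_A$. An arrow $f$ is inverted by $\mathsf{Z}$ if $\mathsf{Z}(f)$ is an isomorphism. $\mathcal{N}_{\mathcal{Z}}$ denotes the class of arrows of $\mathcal{C}$ factoring through an object of $\mathcal{Z}$. A $\mathcal{Z}$-kernel of $f\colon A\to B$ is an arrow $k\colon K\to A$ with $fk\in\mathcal{N}_{\mathcal{Z}}$ such that every $e\colon E\to A$ with $fe\in\mathcal{N}_{\mathcal{Z}}$ factors uniquely through $k$; $\mathcal{Z}$-cokernels are defined dually; an arrow "is a $\mathcal{Z}$-(co)kernel" if it is one of some arrow. In a category with pullbacks the $\mathcal{Z}$-kernel of $f$ exists (it is the pullback of $\varepsilon_B$ along $f$); its domain is denoted $K[f]$. A sequence $A\xrightarrow{f}B\xrightarrow{g}C$ is short $\mathcal{Z}$-exact if $f$ is a $\mathcal{Z}$-kernel of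 $g$ and $g$ is a $\mathcal{Z}$-cokernel of $f$. A $\mathcal{Z}$-torsion theory is a pair $(\mathcal{T},\mathcal{F})$ of full replete subcategories of $\mathcal{C}$ such that: $\mathcal{T}\cap\mathcal{F}=\mathcal{Z}$; every arrow $T\to F$ with $T\in\mathcal{T}$, $F\in\mathcal{F}$ lies in $\mathcal{N}_{\mathcal{Z}}$; for every $A\in\mathcal{C}$ there is a short $\mathcal{Z}$-exact sequence $\mathsf{T}(A)\xrightarrow{t_A}A\xrightarrow{\eta_A}\mathsf{F}(A)$ with $\mathsf{T}(A)\in\mathcal{T}$, $\mathsf{F}(A)\in\mathcal{F}$ (unique up to isomorphism). Condition (N): for every arrow $f\colon A\to B$ with $\mathcal{Z}$-kernel $k\colon K[f]\to A$, the composite $k\,t_{K[f]}\colon\mathsf{T}(K[f])\to A$ is the $\mathcal{Z}$-kernel of some arrow. Condition (M): for every short $\mathcal{Z}$-exact sequence $T\to A\to Q$ with $T\in\mathcal{T}$, $\mathsf{F}(T)\cong\mathsf{Z}(Q)$. A factorization system is a pair $(\mathbb{E},\mathbb{M})$ of classes of arrows, replete (as full subcategories of the arrow category), such that every arrow factors as $me$ with $e\in\mathbb{E}$, $m\in\mathbb{M}$, and for every commutative square $he=mg$ with $e\in\mathbb{E}$, $m\in\mathbb{M}$ there is a unique $d$ with $de=g$ and $md=h$. It is stable with respect to a class $\mathcal{A}$ of arrows if the pullback of any arrow of $\mathbb{E}$ along an arrow of $\mathcal{A}$ is in $\mathbb{E}$. *)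

theory Defs
  imports Main
begin

section \<open>Categories\<close>

text \<open>Composition is written in the usual order: \<open>g \<cdot> f\<close> is \<open>g\<close> after \<open>f\<close>.
  It is meaningful only when \<open>Cod f = Dom g\<close>, and no definition below looks at other composites.\<close>

record ('o, 'a) cat =
  Ob :: "'o set"
  Ar :: "'a set"
  Dom :: "'a \<Rightarrow> 'o"
  Cod :: "'a \<Rightarrow> 'o"
  ident :: "'o \<Rightarrow> 'a"
  comp :: "'a \<Rightarrow> 'a \<Rightarrow> 'a" (infixl "\<cdot>\<index>" 70)

definition hom :: "('o, 'a) cat \<Rightarrow> 'o \<Rightarrow> 'o \<Rightarrow> 'a set" where
  "hom C A B = {f \<in> Ar C. Dom C f = A \<and> Cod C f = B}"

definition category :: "('o, 'a) cat \<Rightarrow> bool" where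
  "category C \<longleftrightarrow>
     (\<forall>f \<in> Ar C. Dom C f \<in> Ob C \<and> Cod C f \<in> Ob C) \<and>
     (\<forall>A \<in> Ob C. ident C A \<in> hom C A A) \<and>
     (\<forall>f \<in> Ar C. \<forall>g \<in> Ar C. Cod C f = Dom C g \<longrightarrow> g \<cdot>\<^bsub>C\<^esub> f \<in> hom C (Dom C f) (Cod C g)) \<and>
     (\<forall>f \<in> Ar C. f \<cdot>\<^bsub>C\<^esub> ident C (Dom C f) = f \<and> ident C (Cod C f) \<cdot>\<^bsub>C\<^esub> f = f) \<and>
     (\<forall>f \<in> Ar C. \<forall>g \<in> Ar C. \<forall>h \<in> Ar C. Cod C f = Dom C g \<longrightarrow> Cod C g = Dom C h \<longrightarrow>
        h \<cdot>\<^bsub>C\<^esub> (g \<cdot>\<^bsub>C\<^esub> f) = (h \<cdot>\<^bsub>C\<^esub> g) \<cdot>\<^bsub>C\<^esub> f)"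

definition monic :: "('o, 'a) cat \<Rightarrow> 'a \<Rightarrow> bool" where
  "monic C m \<longleftrightarrow> m \<in> Ar C \<and>
     (\<forall>X. \<forall>f \<in> hom C X (Dom C m). \<forall>g \<in> hom C X (Dom C m). m \<cdot>\<^bsub>C\<^esub> f = m \<cdot>\<^bsub>C\<^esub> g \<longrightarrow> f = g)"

definition iso :: "('o, 'a) cat \<Rightarrow> 'a \<Rightarrow> bool" where
  "iso C f \<longleftrightarrow> f \<in> Ar C \<and>
     (\<exists>g \<in> hom C (Cod C f) (Dom C f).
        g \<cdot>\<^bsub>C\<^esub> f = ident C (Dom C f) \<and> f \<cdot>\<^bsub>C\<^esub> g = ident C (Cod C f))"

definition isomorphic :: "('o, 'a) cat \<Rightarrow> 'o \<Rightarrow> 'o \<Rightarrow> bool" where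
  "isomorphic C A B \<longleftrightarrow> (\<exists>f \<in> hom C A B. iso C f)"


section \<open>Regular categories\<close>

definition terminal_object :: "('o, 'a) cat \<Rightarrow> 'o \<Rightarrow> bool" where
  "terminal_object C I \<longleftrightarrow> I \<in> Ob C \<and> (\<forall>A \<in> Ob C. \<exists>!f. f \<in> hom C A I)"

text \<open>\<open>pullback C f g p q\<close>: the square \<open>f \<cdot> p = g \<cdot> q\<close> is a pullback, so that \<open>p\<close> is the
  pullback of \<open>g\<close> along \<open>f\<close> (and \<open>q\<close> that of \<open>f\<close> along \<open>g\<close>).\<close>

definition pullback :: "('o, 'a) cat \<Rightarrow> 'a \<Rightarrow> 'a \<Rightarrow> 'a \<Rightarrow> 'a \<Rightarrow> bool" where
  "pullback C f g p q \<longleftrightarrow>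
     f \<in> Ar C \<and> g \<in> Ar C \<and> p \<in> Ar C \<and> q \<in> Ar C \<and>
     Cod C f = Cod C g \<and> Cod C p = Dom C f \<and> Cod C q = Dom C g \<and> Dom C p = Dom C q \<and>
     f \<cdot>\<^bsub>C\<^esub> p = g \<cdot>\<^bsub>C\<^esub> q \<and>
     (\<forall>X. \<forall>a \<in> hom C X (Dom C f). \<forall>b \<in> hom C X (Dom C g). f \<cdot>\<^bsub>C\<^esub> a = g \<cdot>\<^bsub>C\<^esub> b \<longrightarrow>
        (\<exists>!u. u \<in> hom C X (Dom C p) \<and> p \<cdot>\<^bsub>C\<^esub> u = a \<and> q \<cdot>\<^bsub>C\<^esub> u = b))"

text \<open>Finite limits, given by a terminal object and pullbacks.\<close>

definition finitely_complete :: "('o, 'a) cat \<Rightarrow> bool" where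
  "finitely_complete C \<longleftrightarrow>
     (\<exists>I. terminal_object C I) \<and>
     (\<forall>f \<in> Ar C. \<forall>g \<in> Ar C. Cod C f = Cod C g \<longrightarrow> (\<exists>p q. pullback C f g p q))"

definition coequalizer :: "('o, 'a) cat \<Rightarrow> 'a \<Rightarrow> 'a \<Rightarrow> 'a \<Rightarrow> bool" where
  "coequalizer C p q e \<longleftrightarrow>
     p \<in> Ar C \<and> q \<in> Ar C \<and> e \<in> Ar C \<and>
     Dom C p = Dom C q \<and> Cod C p = Cod C q \<and> Dom C e = Cod C p \<and>
     e \<cdot>\<^bsub>C\<^esub> p = e \<cdot>\<^bsub>C\<^esub> q \<and>
     (\<forall>X. \<forall>h \<in> hom C (Cod C p) X. h \<cdot>\<^bsub>C\<^esub> p = h \<cdot>\<^bsub>C\<^esub> q \<longrightarrow>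
        (\<exists>!u. u \<in> hom C (Cod C e) X \<and> u \<cdot>\<^bsub>C\<^esub> e = h))"

definition regular_epi :: "('o, 'a) cat \<Rightarrow> 'a \<Rightarrow> bool" where
  "regular_epi C e \<longleftrightarrow> (\<exists>p q. coequalizer C p q e)"

text \<open>The middle condition says that kernel pairs, i.e. pullbacks of an arrow along itself,
  have coequalizers.\<close>

definition regular_category :: "('o, 'a) cat \<Rightarrow> bool" where
  "regular_category C \<longleftrightarrow> category C \<and> finitely_complete C \<and>
     (\<forall>f p q. pullback C f f p q \<longrightarrow> (\<exists>e. coequalizer C p q e)) \<and>
     (\<forall>f g p q. regular_epi C g \<longrightarrow> pullback C f g p q \<longrightarrow> regular_epi C p)"


section \<open>Classes of zero objects\<close>

text \<open>A full subcategory is represented by its set of objects.\<close>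

definition full_sub :: "('o, 'a) cat \<Rightarrow> 'o set \<Rightarrow> ('o, 'a) cat" where
  "full_sub C S = C\<lparr>Ob := S, Ar := {f \<in> Ar C. Dom C f \<in> S \<and> Cod C f \<in> S}\<rparr>"

definition replete :: "('o, 'a) cat \<Rightarrow> 'o set \<Rightarrow> bool" where
  "replete C S \<longleftrightarrow> S \<subseteq> Ob C \<and> (\<forall>A \<in> S. \<forall>B. isomorphic C A B \<longrightarrow> B \<in> S)"

definition is_functor ::
  "('o, 'a) cat \<Rightarrow> ('p, 'b) cat \<Rightarrow> ('o \<Rightarrow> 'p) \<Rightarrow> ('a \<Rightarrow> 'b) \<Rightarrow> bool" where
  "is_functor C D Fo Fa \<longleftrightarrow>
     (\<forall>A \<in> Ob C. Fo A \<in> Ob D) \<and>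
     (\<forall>f \<in> Ar C. Fa f \<in> hom D (Fo (Dom C f)) (Fo (Cod C f))) \<and>
     (\<forall>A \<in> Ob C. Fa (ident C A) = ident D (Fo A)) \<and>
     (\<forall>f \<in> Ar C. \<forall>g \<in> Ar C. Cod C f = Dom C g \<longrightarrow> Fa (g \<cdot>\<^bsub>C\<^esub> f) = Fa g \<cdot>\<^bsub>D\<^esub> Fa f)"

text \<open>\<open>(Zo, Za)\<close>, on objects and on arrows, is a right adjoint of the inclusion of the full
  subcategory \<open>Z\<close>, with counit \<open>eps\<close>.\<close>

definition coreflector ::
  "('o, 'a) cat \<Rightarrow> 'o set \<Rightarrow> ('o \<Rightarrow> 'o) \<Rightarrow> ('a \<Rightarrow> 'a) \<Rightarrow> ('o \<Rightarrow> 'a) \<Rightarrow> bool" where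
  "coreflector C Z Zo Za eps \<longleftrightarrow>
     is_functor C (full_sub C Z) Zo Za \<and>
     (\<forall>A \<in> Ob C. eps A \<in> hom C (Zo A) A) \<and>
     (\<forall>f \<in> Ar C. eps (Cod C f) \<cdot>\<^bsub>C\<^esub> Za f = f \<cdot>\<^bsub>C\<^esub> eps (Dom C f)) \<and>
     (\<forall>A \<in> Ob C. \<forall>X \<in> Z. \<forall>x \<in> hom C X A. \<exists>!u. u \<in> hom C X (Zo A) \<and> eps A \<cdot>\<^bsub>C\<^esub> u = x)"

definition zero_object_class ::
  "('o, 'a) cat \<Rightarrow> 'o set \<Rightarrow> ('o \<Rightarrow> 'o) \<Rightarrow> ('a \<Rightarrow> 'a) \<Rightarrow> ('o \<Rightarrow> 'a) \<Rightarrow> bool" where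
  "zero_object_class C Z Zo Za eps \<longleftrightarrow>
     replete C Z \<and>
     (\<forall>X \<in> Z. \<forall>Y \<in> Z. \<forall>f \<in> hom C X Y. \<forall>g \<in> hom C X Y. f = g) \<and>
     coreflector C Z Zo Za eps \<and>
     (\<forall>A \<in> Ob C. monic C (eps A)) \<and>
     (\<forall>m. monic C m \<longrightarrow> iso C (Za m))"

text \<open>\<open>V\<close> and \<open>v\<close> witness that the class \<open>Z\<close> of zero objects is terminal. Uniqueness of \<open>phi\<close>
  is automatic, \<open>Z\<close> being posetal.\<close>

definition terminal_class ::
  "('o, 'a) cat \<Rightarrow> 'o set \<Rightarrow> ('o \<Rightarrow> 'o) \<Rightarrow> ('o \<Rightarrow> 'a) \<Rightarrow> bool" where
  "terminal_class C Z V v \<longleftrightarrow>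
     (\<forall>A \<in> Ob C. V A \<in> Z \<and> v A \<in> hom C A (V A) \<and>
        (\<forall>X \<in> Z. \<forall>x \<in> hom C A X. \<exists>phi \<in> hom C X (V A). phi \<cdot>\<^bsub>C\<^esub> x = v A))"

definition inverted :: "('o, 'a) cat \<Rightarrow> ('a \<Rightarrow> 'a) \<Rightarrow> 'a set" where
  "inverted C Za = {f \<in> Ar C. iso C (Za f)}"


section \<open>Kernels, cokernels and exact sequences relative to \<open>Z\<close>\<close>

definition zero_arrows :: "('o, 'a) cat \<Rightarrow> 'o set \<Rightarrow> 'a set" where
  "zero_arrows C Z = {f \<in> Ar C. \<exists>X \<in> Z. \<exists>a \<in> hom C (Dom C f) X. \<exists>b \<in> hom C X (Cod C f). f = b \<cdot>\<^bsub>C\<^esub> a}"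

definition zkernel :: "('o, 'a) cat \<Rightarrow> 'o set \<Rightarrow> 'a \<Rightarrow> 'a \<Rightarrow> bool" where
  "zkernel C Z f k \<longleftrightarrow>
     f \<in> Ar C \<and> k \<in> Ar C \<and> Cod C k = Dom C f \<and> f \<cdot>\<^bsub>C\<^esub> k \<in> zero_arrows C Z \<and>
     (\<forall>X. \<forall>e \<in> hom C X (Dom C f). f \<cdot>\<^bsub>C\<^esub> e \<in> zero_arrows C Z \<longrightarrow>
        (\<exists>!u. u \<in> hom C X (Dom C k) \<and> k \<cdot>\<^bsub>C\<^esub> u = e))"

definition zcokernel :: "('o, 'a) cat \<Rightarrow> 'o set \<Rightarrow> 'a \<Rightarrow> 'a \<Rightarrow> bool" where
  "zcokernel C Z f q \<longleftrightarrow>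
     f \<in> Ar C \<and> q \<in> Ar C \<and> Dom C q = Cod C f \<and> q \<cdot>\<^bsub>C\<^esub> f \<in> zero_arrows C Z \<and>
     (\<forall>X. \<forall>e \<in> hom C (Cod C f) X. e \<cdot>\<^bsub>C\<^esub> f \<in> zero_arrows C Z \<longrightarrow>
        (\<exists>!u. u \<in> hom C (Cod C q) X \<and> u \<cdot>\<^bsub>C\<^esub> q = e))"

definition short_exact :: "('o, 'a) cat \<Rightarrow> 'o set \<Rightarrow> 'a \<Rightarrow> 'a \<Rightarrow> bool" where
  "short_exact C Z f g \<longleftrightarrow> zkernel C Z g f \<and> zcokernel C Z f g"


section \<open>Torsion theories\<close>

definition torsion_sequence ::
  "('o, 'a) cat \<Rightarrow> 'o set \<Rightarrow> 'o set \<Rightarrow> 'o set \<Rightarrow> 'o \<Rightarrow> 'a \<Rightarrow> 'a \<Rightarrow> bool" where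
  "torsion_sequence C Z T F A t h \<longleftrightarrow>
     short_exact C Z t h \<and> Cod C t = A \<and> Dom C t \<in> T \<and> Cod C h \<in> F"

definition torsion_theory :: "('o, 'a) cat \<Rightarrow> 'o set \<Rightarrow> 'o set \<Rightarrow> 'o set \<Rightarrow> bool" where
  "torsion_theory C Z T F \<longleftrightarrow>
     replete C T \<and> replete C F \<and> T \<inter> F = Z \<and>
     (\<forall>A \<in> T. \<forall>B \<in> F. hom C A B \<subseteq> zero_arrows C Z) \<and>
     (\<forall>A \<in> Ob C. \<exists>t h. torsion_sequence C Z T F A t h)"

text \<open>Since kernels and torsion sequences are unique up to isomorphism, the next two conditions
  do not depend on a choice of them; they are stated for every choice.\<close>

definition condition_N :: "('o, 'a) cat \<Rightarrow> 'o set \<Rightarrow> 'o set \<Rightarrow> 'o set \<Rightarrow> bool" where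
  "condition_N C Z T F \<longleftrightarrow>
     (\<forall>f k t h. zkernel C Z f k \<longrightarrow> torsion_sequence C Z T F (Dom C k) t h \<longrightarrow>
        (\<exists>g. zkernel C Z g (k \<cdot>\<^bsub>C\<^esub> t)))"

definition condition_M ::
  "('o, 'a) cat \<Rightarrow> 'o set \<Rightarrow> ('o \<Rightarrow> 'o) \<Rightarrow> 'o set \<Rightarrow> 'o set \<Rightarrow> bool" where
  "condition_M C Z Zo T F \<longleftrightarrow>
     (\<forall>k q t h. short_exact C Z k q \<longrightarrow> Dom C k \<in> T \<longrightarrow>
        torsion_sequence C Z T F (Dom C k) t h \<longrightarrow> isomorphic C (Cod C h) (Zo (Cod C q)))"


section \<open>Factorization systems\<close>

text \<open>Closure under isomorphism in the arrow category.\<close>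

definition replete_arrows :: "('o, 'a) cat \<Rightarrow> 'a set \<Rightarrow> bool" where
  "replete_arrows C E \<longleftrightarrow> E \<subseteq> Ar C \<and>
     (\<forall>f \<in> E. \<forall>g \<in> Ar C. \<forall>a \<in> hom C (Dom C f) (Dom C g). \<forall>b \<in> hom C (Cod C f) (Cod C g).
        iso C a \<longrightarrow> iso C b \<longrightarrow> b \<cdot>\<^bsub>C\<^esub> f = g \<cdot>\<^bsub>C\<^esub> a \<longrightarrow> g \<in> E)"

definition factorization_system :: "('o, 'a) cat \<Rightarrow> 'a set \<Rightarrow> 'a set \<Rightarrow> bool" where
  "factorization_system C E M \<longleftrightarrow>
     replete_arrows C E \<and> replete_arrows C M \<and>
     (\<forall>f \<in> Ar C. \<exists>e \<in> E. \<exists>m \<in> M. Cod C e = Dom C m \<and> f = m \<cdot>\<^bsub>C\<^esub> e) \<and>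
     (\<forall>e \<in> E. \<forall>m \<in> M. \<forall>g \<in> hom C (Dom C e) (Dom C m). \<forall>h \<in> hom C (Cod C e) (Cod C m).
        h \<cdot>\<^bsub>C\<^esub> e = m \<cdot>\<^bsub>C\<^esub> g \<longrightarrow>
        (\<exists>!d. d \<in> hom C (Cod C e) (Dom C m) \<and> d \<cdot>\<^bsub>C\<^esub> e = g \<and> m \<cdot>\<^bsub>C\<^esub> d = h))"

definition stable_along :: "('o, 'a) cat \<Rightarrow> 'a set \<Rightarrow> 'a set \<Rightarrow> bool" where
  "stable_along C E A \<longleftrightarrow> (\<forall>e \<in> E. \<forall>a \<in> A. \<forall>p q. pullback C a e p q \<longrightarrow> p \<in> E)"

end

theory Submission
  imports Defs
begin

text \<open>The torsion part of an object \<open>A\<close> comes from the factorization \<open>v A = m \<cdot> e\<close>: the \<open>Z\<close>-kernel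
  of \<open>e\<close> is the pullback of \<open>e\<close> along the counit at the codomain of \<open>e\<close>, which is inverted by the
  coreflector, so stability provides an arrow in \<open>E\<close> from the domain of that kernel to an object of
  \<open>Z\<close>. The other ingredient is that arrows in \<open>M\<close> reflect the \<open>Z\<close>-triviality of arrows with domain
  in \<open>T\<close>. Consequently, if \<open>f = m \<cdot> e\<close> has \<open>Z\<close>-kernel \<open>k\<close>, the torsion part of the domain of \<open>k\<close>
  is the \<open>Z\<close>-kernel of \<open>e\<close>, which gives Condition (N); and a \<open>Z\<close>-cokernel \<open>q\<close> of an arrow with
  domain in \<open>T\<close> is itself in \<open>E\<close>, which gives Condition (M).\<close>

section \<open>Kernels and cokernels relative to a class of zero objects\<close>

locale cat =
  fixes C :: "('o, 'a) cat" (structure)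
  assumes category: "category C"
begin

lemma homD: "f \<in> hom C A B \<Longrightarrow> f \<in> Ar C \<and> Dom C f = A \<and> Cod C f = B"
  by (simp add: hom_def)

lemma hom_self: "f \<in> Ar C \<Longrightarrow> f \<in> hom C (Dom C f) (Cod C f)"
  by (simp add: hom_def)

lemma hom_Ob: "f \<in> hom C A B \<Longrightarrow> A \<in> Ob C \<and> B \<in> Ob C"
  using category by (auto simp: category_def hom_def)

lemma ident_hom: "A \<in> Ob C \<Longrightarrow> ident C A \<in> hom C A A"
  using category by (auto simp: category_def)

lemma comp_hom:
  assumes "f \<in> hom C A B" "g \<in> hom C B D"
  shows "g \<cdot> f \<in> hom C A D"
proof -
  have "\<forall>f \<in> Ar C. \<forall>g \<in> Ar C. Cod C f = Dom C g \<longrightarrow> g \<cdot> f \<in> hom C (Dom C f) (Cod C g)"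
    using category by (simp add: category_def)
  then show ?thesis using assms homD by metis
qed

lemma comp_ident: "f \<in> hom C A B \<Longrightarrow> f \<cdot> ident C A = f"
  using category by (auto simp: category_def hom_def)

lemma ident_comp: "f \<in> hom C A B \<Longrightarrow> ident C B \<cdot> f = f"
  using category by (auto simp: category_def hom_def)

lemma assoc:
  assumes "f \<in> hom C A B" "g \<in> hom C B D" "h \<in> hom C D G"
  shows "h \<cdot> (g \<cdot> f) = (h \<cdot> g) \<cdot> f"
proof -
  have "\<forall>f \<in> Ar C. \<forall>g \<in> Ar C. \<forall>h \<in> Ar C. Cod C f = Dom C g \<longrightarrow> Cod C g = Dom C h \<longrightarrow>
      h \<cdot> (g \<cdot> f) = (h \<cdot> g) \<cdot> f"
    using category by (simp add: category_def)
  then show ?thesis using assms homD by metis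
qed

lemma isoI:
  assumes "f \<in> hom C A B" "g \<in> hom C B A" "g \<cdot> f = ident C A" "f \<cdot> g = ident C B"
  shows "iso C f"
  using assms unfolding iso_def by (auto simp: hom_def)

lemma isoE:
  assumes "iso C f" "f \<in> hom C A B"
  obtains g where "g \<in> hom C B A" "g \<cdot> f = ident C A" "f \<cdot> g = ident C B"
  using assms unfolding iso_def by (auto simp: hom_def)

lemma iso_ident: "A \<in> Ob C \<Longrightarrow> iso C (ident C A)"
  by (rule isoI) (auto intro: ident_hom comp_ident)

lemma isomorphicI: "f \<in> hom C A B \<Longrightarrow> iso C f \<Longrightarrow> isomorphic C A B"
  unfolding isomorphic_def by blast

lemma monicD:
  "monic C m \<Longrightarrow> m \<in> hom C A B \<Longrightarrow> f \<in> hom C X A \<Longrightarrow> g \<in> hom C X A \<Longrightarrow> m \<cdot> f = m \<cdot> g \<Longrightarrow> f = g"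
  unfolding monic_def hom_def by blast

lemma replete_arrowsD:
  assumes "replete_arrows C S" "f \<in> S" "f \<in> hom C A B" "g \<in> hom C A' B'"
    and "a \<in> hom C A A'" "b \<in> hom C B B'" "iso C a" "iso C b" "b \<cdot> f = g \<cdot> a"
  shows "g \<in> S"
proof -
  have "Dom C f = A" "Cod C f = B" "Dom C g = A'" "Cod C g = B'" "g \<in> Ar C"
    using assms(3,4) by (auto simp: hom_def)
  with assms show ?thesis
    unfolding replete_arrows_def by blast
qed

end

section \<open>Zero objects, counits and null arrows\<close>

locale zero_class = cat C for C :: "('o, 'a) cat" (structure) +
  fixes Z :: "'o set" and Zo :: "'o \<Rightarrow> 'o" and Za :: "'a \<Rightarrow> 'a" and eps :: "'o \<Rightarrow> 'a"
  assumes zero_object_class: "zero_object_class C Z Zo Za eps"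
begin

abbreviation null :: "'a \<Rightarrow> bool" where
  "null f \<equiv> f \<in> zero_arrows C Z"

lemma replete_Z: "replete C Z"
  using zero_object_class by (simp add: zero_object_class_def)

lemma Z_Ob: "X \<in> Z \<Longrightarrow> X \<in> Ob C"
  using replete_Z by (auto simp: replete_def)

lemma Z_iso: "X \<in> Z \<Longrightarrow> f \<in> hom C X B \<Longrightarrow> iso C f \<Longrightarrow> B \<in> Z"
  using replete_Z isomorphicI unfolding replete_def by blast

lemma posetal: "X \<in> Z \<Longrightarrow> Y \<in> Z \<Longrightarrow> f \<in> hom C X Y \<Longrightarrow> g \<in> hom C X Y \<Longrightarrow> f = g"
  using zero_object_class unfolding zero_object_class_def by blast

text \<open>Both composites are endomorphisms of zero objects, and posetality makes these
  identities.\<close>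

lemma Z_isoI: "X \<in> Z \<Longrightarrow> Y \<in> Z \<Longrightarrow> f \<in> hom C X Y \<Longrightarrow> g \<in> hom C Y X \<Longrightarrow> iso C f"
  by (meson Z_Ob comp_hom ident_hom isoI posetal)

lemma coreflector: "coreflector C Z Zo Za eps"
  using zero_object_class by (simp add: zero_object_class_def)

lemma Zo_Z: "A \<in> Ob C \<Longrightarrow> Zo A \<in> Z"
  using coreflector unfolding coreflector_def is_functor_def by (simp add: full_sub_def)

lemma eps_hom: "A \<in> Ob C \<Longrightarrow> eps A \<in> hom C (Zo A) A"
  using coreflector unfolding coreflector_def by simp

lemma eps_monic: "A \<in> Ob C \<Longrightarrow> monic C (eps A)"
  using zero_object_class by (simp add: zero_object_class_def)

text \<open>Counits are monic and the coreflector inverts monomorphisms; this is what lets stability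
  of \<open>E\<close> apply to pullbacks along counits.\<close>

lemma eps_inverted: "A \<in> Ob C \<Longrightarrow> eps A \<in> inverted C Za"
  using zero_object_class eps_hom by (auto simp: zero_object_class_def inverted_def hom_def)

lemma eps_factor:
  assumes "X \<in> Z" "x \<in> hom C X A"
  obtains u where "u \<in> hom C X (Zo A)" "eps A \<cdot> u = x"
  using assms coreflector hom_Ob unfolding coreflector_def by blast

lemma nullI:
  "X \<in> Z \<Longrightarrow> a \<in> hom C A X \<Longrightarrow> b \<in> hom C X B \<Longrightarrow> null (b \<cdot> a)"
  using comp_hom[of a A X b B] unfolding zero_arrows_def hom_def by auto

lemma nullE:
  assumes "null f" "f \<in> hom C A B"
  obtains X a b where "X \<in> Z" "a \<in> hom C A X" "b \<in> hom C X B" "f = b \<cdot> a"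
  using assms unfolding zero_arrows_def hom_def by blast

text \<open>A normal form for null arrows: the second half of any factorization through a zero
  object passes through the counit at \<open>B\<close>, by its universal property.\<close>

lemma null_eps:
  assumes "null f" "f \<in> hom C A B"
  obtains a where "a \<in> hom C A (Zo B)" "f = eps B \<cdot> a"
proof -
  obtain X a b where X: "X \<in> Z" and a: "a \<in> hom C A X" and b: "b \<in> hom C X B" and f: "f = b \<cdot> a"
    using nullE[OF assms] .
  obtain u where u: "u \<in> hom C X (Zo B)" "eps B \<cdot> u = b"
    using eps_factor[OF X b] .
  have "B \<in> Ob C" using b hom_Ob by blast
  then have "f = eps B \<cdot> (u \<cdot> a)"
    using assoc[OF a u(1) eps_hom] u(2) f by simp
  then show thesis using that comp_hom[OF a u(1)] by blast
qed

lemma null_to_Z: "X \<in> Z \<Longrightarrow> f \<in> hom C A X \<Longrightarrow> null f"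
  using nullI[of X f A "ident C X" X] by (simp add: Z_Ob ident_hom ident_comp)

lemma null_comp_left:
  assumes "null f" "f \<in> hom C A B" "g \<in> hom C B D"
  shows "null (g \<cdot> f)"
proof -
  obtain X a b where X: "X \<in> Z" "a \<in> hom C A X" "b \<in> hom C X B" "f = b \<cdot> a"
    using nullE[OF assms(1,2)] .
  have "g \<cdot> f = (g \<cdot> b) \<cdot> a" using assoc[OF X(2,3) assms(3)] X(4) by simp
  then show ?thesis using nullI[OF X(1,2) comp_hom[OF X(3) assms(3)]] by simp
qed

lemma null_comp_right:
  assumes "null f" "f \<in> hom C A B" "g \<in> hom C D A"
  shows "null (f \<cdot> g)"
proof -
  obtain X a b where X: "X \<in> Z" "a \<in> hom C A X" "b \<in> hom C X B" "f = b \<cdot> a"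
    using nullE[OF assms(1,2)] .
  have "f \<cdot> g = b \<cdot> (a \<cdot> g)" using assoc[OF assms(3) X(2,3)] X(4) by simp
  then show ?thesis using nullI[OF X(1) comp_hom[OF assms(3) X(2)] X(3)] by simp
qed

section \<open>Kernels and cokernels relative to \<open>Z\<close>\<close>

lemma zkernel_hom:
  assumes "zkernel C Z f k" "f \<in> hom C A B"
  shows "k \<in> hom C (Dom C k) A" "null (f \<cdot> k)"
  using assms unfolding zkernel_def hom_def by auto

lemma zkernel_factor:
  assumes "zkernel C Z f k" "f \<in> hom C A B" "x \<in> hom C X A" "null (f \<cdot> x)"
  obtains u where "u \<in> hom C X (Dom C k)" "k \<cdot> u = x"
  using assms homD[OF assms(2)] unfolding zkernel_def by blast

text \<open>Null arrows are closed under precomposition, so \<open>k \<cdot> u\<close> is itself an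
  arrow to which the universal property of \<open>k\<close> applies. Hence kernels are
  monic.\<close>

lemma zkernel_unique:
  assumes k: "zkernel C Z f k" and f: "f \<in> hom C A B"
    and uw: "u \<in> hom C X (Dom C k)" "w \<in> hom C X (Dom C k)" "k \<cdot> u = k \<cdot> w"
  shows "u = w"
proof -
  note kh = zkernel_hom[OF k f]
  have "null (f \<cdot> (k \<cdot> u))"
    using null_comp_right[OF kh(2) comp_hom[OF kh(1) f] uw(1)] assoc[OF uw(1) kh(1) f] by simp
  moreover have "k \<cdot> u \<in> hom C X (Dom C f)"
    using comp_hom[OF uw(1) kh(1)] homD[OF f] by simp
  ultimately have "\<exists>!x. x \<in> hom C X (Dom C k) \<and> k \<cdot> x = k \<cdot> u"
    using k unfolding zkernel_def by blast
  then show ?thesis using uw by auto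
qed

lemma zkernelI:
  assumes "f \<in> hom C A B" "k \<in> hom C K A" "null (f \<cdot> k)"
    and "\<And>X x. x \<in> hom C X A \<Longrightarrow> null (f \<cdot> x) \<Longrightarrow> \<exists>u \<in> hom C X K. k \<cdot> u = x"
    and "\<And>X u w. u \<in> hom C X K \<Longrightarrow> w \<in> hom C X K \<Longrightarrow> k \<cdot> u = k \<cdot> w \<Longrightarrow> u = w"
  shows "zkernel C Z f k"
proof -
  have d: "f \<in> Ar C" "Dom C f = A" "k \<in> Ar C" "Cod C k = A" "Dom C k = K"
    using assms(1,2) by (auto simp: hom_def)
  show ?thesis
    unfolding zkernel_def d
  proof (intro conjI allI ballI impI)
    fix X x assume "x \<in> hom C X A" "null (f \<cdot> x)"
    then obtain u where "u \<in> hom C X K" "k \<cdot> u = x" using assms(4) by blast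
    then show "\<exists>!u. u \<in> hom C X K \<and> k \<cdot> u = x"
      using assms(5) by blast
  qed (use d assms(3) in auto)
qed

lemma zcokernel_hom:
  assumes "zcokernel C Z f q" "f \<in> hom C A B"
  shows "q \<in> hom C B (Cod C q)" "null (q \<cdot> f)"
  using assms unfolding zcokernel_def hom_def by auto

lemma zcokernel_arrow_hom: "zcokernel C Z f q \<Longrightarrow> q \<in> hom C B D \<Longrightarrow> f \<in> hom C (Dom C f) B"
  unfolding zcokernel_def hom_def by auto

lemma zcokernel_factor:
  assumes "zcokernel C Z f q" "f \<in> hom C A B" "x \<in> hom C B X" "null (x \<cdot> f)"
  obtains u where "u \<in> hom C (Cod C q) X" "u \<cdot> q = x"
  using assms homD[OF assms(2)] unfolding zcokernel_def by blast

text \<open>Dual to \<open>zkernel_unique\<close>; through it every arrow of \<open>E\<close>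
  becomes epic.\<close>

lemma zcokernel_epic:
  assumes q: "zcokernel C Z f q" "q \<in> hom C B D"
    and uw: "u \<in> hom C D X" "w \<in> hom C D X" "u \<cdot> q = w \<cdot> q"
  shows "u = w"
proof -
  note f = zcokernel_arrow_hom[OF q]
  have "null ((u \<cdot> q) \<cdot> f)"
    using null_comp_left[OF zcokernel_hom(2)[OF q(1) f] comp_hom[OF f q(2)] uw(1)]
      assoc[OF f q(2) uw(1)] by simp
  moreover have "u \<cdot> q \<in> hom C (Cod C f) X"
    using comp_hom[OF q(2) uw(1)] homD[OF f] by simp
  ultimately have "\<exists>!x. x \<in> hom C (Cod C q) X \<and> x \<cdot> q = u \<cdot> q"
    using q(1) unfolding zcokernel_def by blast
  then show ?thesis using uw homD[OF q(2)] by auto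
qed

text \<open>Since \<open>f\<close> factors through \<open>k\<close>, any arrow with null composite
  with \<open>k\<close> has null composite with \<open>f\<close>, hence factors through
  \<open>e\<close>. Short exactness needs a cokernel of the kernel itself, not just of some
  arrow.\<close>

lemma zcokernel_of_zkernel:
  assumes e: "zcokernel C Z f e" "e \<in> hom C A B" and k: "zkernel C Z e k"
  shows "zcokernel C Z k e"
proof -
  note f = zcokernel_arrow_hom[OF e]
  note kh = zkernel_hom[OF k e(2)]
  obtain u where u: "u \<in> hom C (Dom C f) (Dom C k)" "k \<cdot> u = f"
    using zkernel_factor[OF k e(2) f zcokernel_hom(2)[OF e(1) f]] .
  have d: "Cod C k = A" "Cod C e = B" "Dom C e = A" "k \<in> Ar C" "e \<in> Ar C"
    using homD[OF kh(1)] homD[OF e(2)] by auto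
  show ?thesis
    unfolding zcokernel_def d
  proof (intro conjI allI ballI impI)
    fix X x assume x: "x \<in> hom C A X" and n: "null (x \<cdot> k)"
    have "null (x \<cdot> f)"
      using null_comp_right[OF n comp_hom[OF kh(1) x] u(1)] assoc[OF u(1) kh(1) x] u(2) by simp
    then obtain w where "w \<in> hom C B X" "w \<cdot> e = x"
      using zcokernel_factor[OF e(1) f x] d by metis
    then show "\<exists>!u. u \<in> hom C B X \<and> u \<cdot> e = x"
      using zcokernel_epic[OF e] by blast
  qed (use d kh in auto)
qed

text \<open>An arrow into \<open>B\<close> is null exactly when it factors through
  \<open>eps B\<close>, so arrows \<open>x\<close> with \<open>e \<cdot> x\<close> null are the ones
  completing to a cone over the pullback square. The type of \<open>p\<close> is recorded because
  \<open>p\<close> is the arrow that stability places in \<open>E\<close>.\<close>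

lemma pullback_eps_zkernel:
  assumes pb: "pullback C (eps B) e p s" and e: "e \<in> hom C A B"
  shows "zkernel C Z e s" "p \<in> hom C (Dom C s) (Zo B)"
proof -
  have B: "B \<in> Ob C" using hom_Ob[OF e] by simp
  note eps = eps_hom[OF B]
  have s: "s \<in> hom C (Dom C s) A" and p: "p \<in> hom C (Dom C s) (Zo B)"
    and sq: "eps B \<cdot> p = e \<cdot> s"
    using pb homD[OF e] homD[OF eps] by (auto simp: pullback_def hom_def)
  have univ: "\<exists>!u. u \<in> hom C X (Dom C s) \<and> p \<cdot> u = a \<and> s \<cdot> u = b"
    if "a \<in> hom C X (Zo B)" "b \<in> hom C X A" "eps B \<cdot> a = e \<cdot> b" for X a b
    using pb that homD[OF e] homD[OF eps] homD[OF p] unfolding pullback_def by metis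
  show "p \<in> hom C (Dom C s) (Zo B)" by fact
  show "zkernel C Z e s"
  proof (rule zkernelI[OF e s])
    show "null (e \<cdot> s)" using nullI[OF Zo_Z[OF B] p eps] sq by simp
  next
    fix X x assume x: "x \<in> hom C X A" and n: "null (e \<cdot> x)"
    obtain a where a: "a \<in> hom C X (Zo B)" "e \<cdot> x = eps B \<cdot> a"
      using null_eps[OF n comp_hom[OF x e]] .
    then show "\<exists>u \<in> hom C X (Dom C s). s \<cdot> u = x"
      using univ[OF a(1) x] by auto
  next
    fix X u w assume u: "u \<in> hom C X (Dom C s)" and w: "w \<in> hom C X (Dom C s)"
      and eq: "s \<cdot> u = s \<cdot> w"
    \<comment> \<open>The monic counit makes the \<open>p\<close>-coordinate depend only on the
      \<open>s\<close>-coordinate, so uniqueness in the pullback suffices.\<close>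
    have "eps B \<cdot> (p \<cdot> u) = eps B \<cdot> (p \<cdot> w)"
      using assoc[OF u p eps] assoc[OF w p eps] assoc[OF u s e] assoc[OF w s e] sq eq by simp
    then have "p \<cdot> u = p \<cdot> w"
      using monicD[OF eps_monic[OF B] eps] comp_hom[OF u p] comp_hom[OF w p] by blast
    moreover have "eps B \<cdot> (p \<cdot> u) = e \<cdot> (s \<cdot> u)"
      using assoc[OF u p eps] assoc[OF u s e] sq by simp
    ultimately show "u = w"
      using univ[OF comp_hom[OF u p] comp_hom[OF u s]] u w eq by metis
  qed
qed

text \<open>The two kernels factor through each other and are monic. This transports facts about the
  pullback kernel to an arbitrary one.\<close>

lemma zkernel_iso:
  assumes e: "e \<in> hom C A B" and k: "zkernel C Z e k" and s: "zkernel C Z e s"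
  obtains i where "i \<in> hom C (Dom C k) (Dom C s)" "iso C i"
proof -
  note kh = zkernel_hom[OF k e] and sh = zkernel_hom[OF s e]
  have Ob: "Dom C k \<in> Ob C" "Dom C s \<in> Ob C" using hom_Ob[OF kh(1)] hom_Ob[OF sh(1)] by auto
  obtain i where i: "i \<in> hom C (Dom C k) (Dom C s)" "s \<cdot> i = k"
    using zkernel_factor[OF s e kh] .
  obtain j where j: "j \<in> hom C (Dom C s) (Dom C k)" "k \<cdot> j = s"
    using zkernel_factor[OF k e sh] .
  have "k \<cdot> (j \<cdot> i) = k \<cdot> ident C (Dom C k)"
    using assoc[OF i(1) j(1) kh(1)] i(2) j(2) comp_ident[OF kh(1)] by simp
  then have "j \<cdot> i = ident C (Dom C k)"
    using zkernel_unique[OF k e] comp_hom[OF i(1) j(1)] ident_hom[OF Ob(1)] by blast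
  moreover have "s \<cdot> (i \<cdot> j) = s \<cdot> ident C (Dom C s)"
    using assoc[OF j(1) i(1) sh(1)] i(2) j(2) comp_ident[OF sh(1)] by simp
  then have "i \<cdot> j = ident C (Dom C s)"
    using zkernel_unique[OF s e] comp_hom[OF j(1) i(1)] ident_hom[OF Ob(2)] by blast
  ultimately show thesis using that i(1) isoI[OF i(1) j(1)] by blast
qed

end

section \<open>The torsion theory of a factorization system\<close>

locale zero_factorization = zero_class C Z Zo Za eps
  for C :: "('o, 'a) cat" (structure) and Z Zo Za eps +
  fixes V :: "'o \<Rightarrow> 'o" and v :: "'o \<Rightarrow> 'a" and E M :: "'a set" and T F :: "'o set"
  assumes pullbacks: "f \<in> Ar C \<Longrightarrow> g \<in> Ar C \<Longrightarrow> Cod C f = Cod C g \<Longrightarrow> \<exists>p q. pullback C f g p q"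
    and terminal: "terminal_class C Z V v"
    and factorization: "factorization_system C E M"
    and stable: "stable_along C E (inverted C Za)"
    and E_zcokernel: "e \<in> E \<Longrightarrow> \<exists>f. zcokernel C Z f e"
    and T_def: "T = {A \<in> Ob C. \<exists>X \<in> Z. \<exists>e \<in> hom C A X. e \<in> E}"
    and F_def: "F = {A \<in> Ob C. v A \<in> M}"
begin

section \<open>The universal arrows \<open>v A\<close>\<close>

lemma V_Z: "A \<in> Ob C \<Longrightarrow> V A \<in> Z"
  using terminal by (simp add: terminal_class_def)

lemma v_hom: "A \<in> Ob C \<Longrightarrow> v A \<in> hom C A (V A)"
  using terminal by (simp add: terminal_class_def)

lemma v_factor:
  assumes "x \<in> hom C A X" "X \<in> Z"
  obtains p where "p \<in> hom C X (V A)" "p \<cdot> x = v A"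
  using assms terminal hom_Ob unfolding terminal_class_def by blast

text \<open>The arrow \<open>v B \<cdot> f\<close> reaches a zero object, so \<open>v A\<close>
  yields \<open>p\<close> from \<open>V B\<close> to \<open>V A\<close>; then
  \<open>p \<cdot> v B\<close> reaches a zero object, so \<open>v B\<close> yields \<open>c\<close>
  back. Thus any arrow at all from \<open>A\<close> to \<open>B\<close> identifies
  \<open>V A\<close> with \<open>V B\<close>.\<close>

lemma V_iso:
  assumes f: "f \<in> hom C A B"
  obtains c where "c \<in> hom C (V A) (V B)" "iso C c" "c \<cdot> v A = v B \<cdot> f"
proof -
  have Ob: "A \<in> Ob C" "B \<in> Ob C" using hom_Ob[OF f] by auto
  note vA = v_hom[OF Ob(1)] and vB = v_hom[OF Ob(2)]
  obtain p where p: "p \<in> hom C (V B) (V A)" "p \<cdot> (v B \<cdot> f) = v A"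
    using v_factor[OF comp_hom[OF f vB] V_Z[OF Ob(2)]] .
  obtain c where c: "c \<in> hom C (V A) (V B)" "c \<cdot> (p \<cdot> v B) = v B"
    using v_factor[OF comp_hom[OF vB p(1)] V_Z[OF Ob(1)]] .
  have "c \<cdot> v A = c \<cdot> ((p \<cdot> v B) \<cdot> f)"
    using p(2) assoc[OF f vB p(1)] by simp
  also have "\<dots> = v B \<cdot> f"
    using assoc[OF f comp_hom[OF vB p(1)] c(1)] c(2) by simp
  finally show thesis using that c(1) Z_isoI[OF V_Z V_Z c(1) p(1)] Ob by blast
qed

section \<open>Factorizations and arrows in \<open>E\<close>\<close>

lemma replete_E: "replete_arrows C E" and replete_M: "replete_arrows C M"
  using factorization by (auto simp: factorization_system_def)

lemma factor:
  assumes "f \<in> hom C A B"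
  obtains e m I where "e \<in> E" "m \<in> M" "e \<in> hom C A I" "m \<in> hom C I B" "f = m \<cdot> e"
proof -
  obtain e m where em: "e \<in> E" "m \<in> M" "Cod C e = Dom C m" "f = m \<cdot> e"
    using factorization assms unfolding factorization_system_def hom_def by blast
  then have h: "e \<in> hom C (Dom C e) (Dom C m)" "m \<in> hom C (Dom C m) (Cod C m)"
    using replete_E replete_M by (auto simp: replete_arrows_def hom_def)
  then have "Dom C e = A" "Cod C m = B"
    using homD[OF comp_hom[OF h]] homD[OF assms] em(4) by auto
  then show thesis using that em h by blast
qed

lemma diagonal:
  assumes "e \<in> E" "m \<in> M" "e \<in> hom C A B" "m \<in> hom C P Q" "g \<in> hom C A P" "h \<in> hom C B Q"
    and "h \<cdot> e = m \<cdot> g"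
  obtains d where "d \<in> hom C B P" "d \<cdot> e = g" "m \<cdot> d = h"
proof -
  have "Dom C e = A" "Cod C e = B" "Dom C m = P" "Cod C m = Q"
    using assms by (auto simp: hom_def)
  then show thesis
    using that factorization assms unfolding factorization_system_def by blast
qed

lemma E_epic:
  assumes "e \<in> E" "e \<in> hom C A B" "u \<in> hom C B X" "w \<in> hom C B X" "u \<cdot> e = w \<cdot> e"
  shows "u = w"
  using E_zcokernel[OF assms(1)] zcokernel_epic[OF _ assms(2-5)] by blast

lemma split_E_iso:
  assumes e: "e \<in> E" "e \<in> hom C A B" and u: "u \<in> hom C B A" "u \<cdot> e = ident C A"
  shows "iso C e"
proof -
  have B: "B \<in> Ob C" using hom_Ob[OF e(2)] by simp
  have "(e \<cdot> u) \<cdot> e = ident C B \<cdot> e"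
    using assoc[OF e(2) u(1) e(2)] u(2) comp_ident[OF e(2)] ident_comp[OF e(2)] by simp
  then have "e \<cdot> u = ident C B"
    using E_epic[OF e comp_hom[OF u(1) e(2)] ident_hom[OF B]] by simp
  then show ?thesis using isoI[OF e(2) u] by simp
qed

text \<open>If \<open>e\<close> is a cokernel of \<open>f\<close>, then \<open>f\<close> ends at a
  zero object and is null, so the identity of \<open>X\<close> factors through \<open>e\<close>. The
  resulting retraction of the epic \<open>e\<close> is its inverse.\<close>

lemma E_from_Z_iso:
  assumes X: "X \<in> Z" and e: "e \<in> E" "e \<in> hom C X B"
  shows "iso C e"
proof -
  obtain f where f: "zcokernel C Z f e" using E_zcokernel[OF e(1)] by blast
  note fh = zcokernel_arrow_hom[OF f e(2)]
  have id: "ident C X \<in> hom C X X" using ident_hom[OF Z_Ob[OF X]] .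
  have "null (ident C X \<cdot> f)"
    using null_to_Z[OF X fh] ident_comp[OF fh] by simp
  then obtain u where "u \<in> hom C (Cod C e) X" "u \<cdot> e = ident C X"
    using zcokernel_factor[OF f fh id] by blast
  then show ?thesis using split_E_iso[OF e] homD[OF e(2)] by simp
qed

section \<open>The classes \<open>T\<close> and \<open>F\<close>: zero objects, orthogonality,
  repleteness and intersection\<close>

lemma Z_subset_T: "Z \<subseteq> T"
proof
  fix X assume X: "X \<in> Z"
  \<comment> \<open>The \<open>E\<close>-part of the identity is the required arrow: it starts at a
    zero object, so it is invertible and ends at one too.\<close>
  obtain e m I where e: "e \<in> E" "e \<in> hom C X I"
    using factor[OF ident_hom[OF Z_Ob[OF X]]] by metis
  then have "I \<in> Z" using Z_iso[OF X e(2)] E_from_Z_iso[OF X e] by simp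
  then show "X \<in> T" using e Z_Ob[OF X] unfolding T_def by blast
qed

text \<open>The \<open>E\<close>-part of \<open>v X\<close> starts at a zero object and is
  invertible, so \<open>v X\<close> is isomorphic as an arrow to its \<open>M\<close>-part.\<close>

lemma Z_subset_F: "Z \<subseteq> F"
proof
  fix X assume X: "X \<in> Z"
  note Ob = Z_Ob[OF X]
  obtain e m I where em: "e \<in> E" "m \<in> M" "e \<in> hom C X I" "m \<in> hom C I (V X)" "v X = m \<cdot> e"
    using factor[OF v_hom[OF Ob]] .
  obtain u where u: "u \<in> hom C I X" "u \<cdot> e = ident C X" "e \<cdot> u = ident C I"
    using isoE[OF E_from_Z_iso[OF X em(1,3)] em(3)] .
  have "v X \<cdot> u = m"
    using assoc[OF u(1) em(3,4)] u(3) comp_ident[OF em(4)] em(5) by simp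
  then have "ident C (V X) \<cdot> m = v X \<cdot> u"
    using ident_comp[OF em(4)] by simp
  moreover have VX: "V X \<in> Ob C" using hom_Ob[OF em(4)] by simp
  moreover have "iso C u" using isoI[OF u(1) em(3) u(3,2)] .
  ultimately have "v X \<in> M"
    using replete_arrowsD[OF replete_M em(2,4) v_hom[OF Ob] u(1) ident_hom[OF VX] _ iso_ident[OF VX]]
    by simp
  then show "X \<in> F" using Ob unfolding F_def by simp
qed

text \<open>As \<open>v A\<close> factors through \<open>e\<close> and \<open>V A\<close> is
  isomorphic to \<open>V B\<close>, the arrow \<open>v B \<cdot> f\<close> also factors through
  \<open>e\<close>. The diagonal of this square, with \<open>e\<close> in \<open>E\<close> opposite
  \<open>v B\<close> in \<open>M\<close>, is \<open>d\<close>.\<close>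

lemma E_to_Z_factor:
  assumes e: "e \<in> E" "e \<in> hom C A X" and X: "X \<in> Z" and B: "B \<in> F" and f: "f \<in> hom C A B"
  obtains d where "d \<in> hom C X B" "d \<cdot> e = f"
proof -
  have Ob: "B \<in> Ob C" and vB: "v B \<in> M" using B unfolding F_def by auto
  obtain c where c: "c \<in> hom C (V A) (V B)" "c \<cdot> v A = v B \<cdot> f"
    using V_iso[OF f] by metis
  obtain p where p: "p \<in> hom C X (V A)" "p \<cdot> e = v A"
    using v_factor[OF e(2) X] .
  have "(c \<cdot> p) \<cdot> e = v B \<cdot> f"
    using assoc[OF e(2) p(1) c(1)] p(2) c(2) by simp
  then show thesis
    using diagonal[OF e(1) vB e(2) v_hom[OF Ob] f comp_hom[OF p(1) c(1)]] that by blast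
qed

text \<open>The null composite passes through the zero object \<open>Zo Q\<close>, which is in
  \<open>F\<close>, so it extends along the \<open>E\<close>-arrow from \<open>A\<close> to some
  \<open>X\<close> in \<open>Z\<close>. The diagonal against \<open>m\<close> then sends
  \<open>g\<close> through \<open>X\<close>.\<close>

lemma M_reflects_null:
  assumes A: "A \<in> T" and m: "m \<in> M" "m \<in> hom C P Q" and g: "g \<in> hom C A P" and n: "null (m \<cdot> g)"
  shows "null g"
proof -
  obtain X e where X: "X \<in> Z" and e: "e \<in> E" "e \<in> hom C A X" using A unfolding T_def by blast
  have Q: "Q \<in> Ob C" using hom_Ob[OF m(2)] by simp
  obtain a where a: "a \<in> hom C A (Zo Q)" "m \<cdot> g = eps Q \<cdot> a"
    using null_eps[OF n comp_hom[OF g m(2)]] .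
  have "Zo Q \<in> F" using Zo_Z[OF Q] Z_subset_F by blast
  then obtain d where d: "d \<in> hom C X (Zo Q)" "d \<cdot> e = a"
    using E_to_Z_factor[OF e X _ a(1)] by blast
  have "(eps Q \<cdot> d) \<cdot> e = m \<cdot> g"
    using assoc[OF e(2) d(1) eps_hom[OF Q]] d(2) a(2) by simp
  then obtain d' where "d' \<in> hom C X P" "d' \<cdot> e = g"
    using diagonal[OF e(1) m(1) e(2) m(2) g comp_hom[OF d(1) eps_hom[OF Q]]] by blast
  then show ?thesis using nullI[OF X e(2)] by blast
qed

text \<open>Composing with \<open>v B\<close> gives a null arrow, and \<open>v B\<close>, being in
  \<open>M\<close>, reflects this.\<close>

lemma T_to_F_null:
  assumes "A \<in> T" "B \<in> F" "f \<in> hom C A B"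
  shows "null f"
proof -
  have B: "B \<in> Ob C" "v B \<in> M" using assms(2) unfolding F_def by auto
  show ?thesis
    using M_reflects_null[OF assms(1) B(2) v_hom[OF B(1)] assms(3)]
      null_to_Z[OF V_Z[OF B(1)] comp_hom[OF assms(3) v_hom[OF B(1)]]] by simp
qed

lemma E_precomp_iso:
  assumes e: "e \<in> E" "e \<in> hom C A X" and i: "i \<in> hom C B A" "iso C i"
  shows "e \<cdot> i \<in> E"
proof -
  obtain j where j: "j \<in> hom C A B" "j \<cdot> i = ident C B" "i \<cdot> j = ident C A"
    using isoE[OF i(2,1)] .
  have X: "X \<in> Ob C" using hom_Ob[OF e(2)] by simp
  have "ident C X \<cdot> e = (e \<cdot> i) \<cdot> j"
    using assoc[OF j(1) i(1) e(2)] j(3) comp_ident[OF e(2)] ident_comp[OF e(2)] by simp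
  then show ?thesis
    using replete_arrowsD[OF replete_E e comp_hom[OF i(1) e(2)] j(1) ident_hom[OF X]
        isoI[OF j(1) i(1) j(3,2)] iso_ident[OF X]] by simp
qed

lemma replete_T: "replete C T"
  unfolding replete_def
proof (intro conjI ballI allI impI)
  show "T \<subseteq> Ob C" unfolding T_def by blast
  fix A B assume A: "A \<in> T" and "isomorphic C A B"
  then obtain i where i: "i \<in> hom C A B" "iso C i" unfolding isomorphic_def by blast
  obtain j where j: "j \<in> hom C B A" "j \<cdot> i = ident C A" "i \<cdot> j = ident C B"
    using isoE[OF i(2,1)] .
  obtain X e where X: "X \<in> Z" and e: "e \<in> E" "e \<in> hom C A X" using A unfolding T_def by blast
  have "e \<cdot> j \<in> E" using E_precomp_iso[OF e j(1) isoI[OF j(1) i(1) j(3,2)]] .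
  then show "B \<in> T"
    using X comp_hom[OF j(1) e(2)] hom_Ob[OF i(1)] unfolding T_def by blast
qed

lemma replete_F: "replete C F"
  unfolding replete_def
proof (intro conjI ballI allI impI)
  show "F \<subseteq> Ob C" unfolding F_def by blast
  fix A B assume A: "A \<in> F" and "isomorphic C A B"
  then obtain i where i: "i \<in> hom C A B" "iso C i" unfolding isomorphic_def by blast
  \<comment> \<open>With \<open>i\<close>, this makes \<open>v A\<close> and \<open>v B\<close>
    isomorphic as arrows, so repleteness of \<open>M\<close> applies.\<close>
  obtain c where c: "c \<in> hom C (V A) (V B)" "iso C c" "c \<cdot> v A = v B \<cdot> i"
    using V_iso[OF i(1)] .
  have Ob: "A \<in> Ob C" "B \<in> Ob C" using hom_Ob[OF i(1)] by auto
  have "v A \<in> M" using A unfolding F_def by simp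
  then have "v B \<in> M"
    using replete_arrowsD[OF replete_M _ v_hom[OF Ob(1)] v_hom[OF Ob(2)] i(1) c(1) i(2) c(2,3)] by simp
  then show "B \<in> F" using Ob unfolding F_def by simp
qed

lemma T_Int_F: "T \<inter> F = Z"
proof
  show "Z \<subseteq> T \<inter> F" using Z_subset_T Z_subset_F by blast
  show "T \<inter> F \<subseteq> Z"
  proof
    fix A assume A: "A \<in> T \<inter> F"
    then obtain X e where X: "X \<in> Z" and e: "e \<in> E" "e \<in> hom C A X" unfolding T_def by blast
    have Ob: "A \<in> Ob C" using hom_Ob[OF e(2)] by simp
    \<comment> \<open>The identity of \<open>A\<close> goes from \<open>T\<close> to
      \<open>F\<close>, so it extends along \<open>e\<close>; posetality turns this retraction into
      an inverse.\<close>
    obtain d where d: "d \<in> hom C X A" "d \<cdot> e = ident C A"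
      using E_to_Z_factor[OF e X _ ident_hom[OF Ob]] A by blast
    have "e \<cdot> d = ident C X"
      using posetal[OF X X comp_hom[OF d(1) e(2)] ident_hom[OF Z_Ob[OF X]]] .
    then have "iso C d" using isoI[OF d(1) e(2)] d(2) by simp
    then show "A \<in> Z" using Z_iso[OF X d(1)] by simp
  qed
qed

section \<open>Kernels of arrows in \<open>E\<close> and torsion sequences\<close>

lemma E_zkernel:
  assumes e: "e \<in> E" "e \<in> hom C A B" and k: "zkernel C Z e k"
  obtains r where "r \<in> E" "r \<in> hom C (Dom C k) (Zo B)"
proof -
  have B: "B \<in> Ob C" using hom_Ob[OF e(2)] by simp
  obtain p s where pb: "pullback C (eps B) e p s"
    using pullbacks[of "eps B" e] homD[OF eps_hom[OF B]] homD[OF e(2)] by auto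
  have p: "p \<in> E"
    using stable e(1) eps_inverted[OF B] pb unfolding stable_along_def by blast
  note s = pullback_eps_zkernel[OF pb e(2)]
  \<comment> \<open>The pullback produces one particular kernel \<open>s\<close>; precomposing with
    \<open>i\<close> moves \<open>p\<close> to the given one.\<close>
  obtain i where i: "i \<in> hom C (Dom C k) (Dom C s)" "iso C i"
    using zkernel_iso[OF e(2) k s(1)] .
  show thesis using that E_precomp_iso[OF p s(2) i] comp_hom[OF i(1) s(2)] by blast
qed

text \<open>Forgets which zero object is reached; Condition (M) will use that it is
  \<open>Zo B\<close>.\<close>

lemma E_zkernel_T:
  assumes "e \<in> E" "e \<in> hom C A B" "zkernel C Z e k"
  shows "Dom C k \<in> T"
proof -
  obtain r where "r \<in> E" "r \<in> hom C (Dom C k) (Zo B)" using E_zkernel[OF assms] .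
  moreover have "Zo B \<in> Z" using Zo_Z hom_Ob[OF assms(2)] by blast
  ultimately show ?thesis using hom_Ob unfolding T_def by blast
qed

lemma zkernel_exists:
  assumes "e \<in> hom C A B"
  obtains k where "zkernel C Z e k"
proof -
  have B: "B \<in> Ob C" using hom_Ob[OF assms] by simp
  obtain p s where pb: "pullback C (eps B) e p s"
    using pullbacks[of "eps B" e] homD[OF eps_hom[OF B]] homD[OF assms] by auto
  show thesis using that pullback_eps_zkernel[OF pb assms] by blast
qed

lemma torsion_sequence_exists:
  assumes A: "A \<in> Ob C"
  shows "\<exists>t h. torsion_sequence C Z T F A t h"
proof -
  obtain e m I where em: "e \<in> E" "m \<in> M" "e \<in> hom C A I" "m \<in> hom C I (V A)" "v A = m \<cdot> e"
    using factor[OF v_hom[OF A]] .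
  obtain k where k: "zkernel C Z e k" using zkernel_exists[OF em(3)] .
  obtain f where "zcokernel C Z f e" using E_zcokernel[OF em(1)] by blast
  then have "short_exact C Z k e"
    using k zcokernel_of_zkernel[OF _ em(3) k] unfolding short_exact_def by blast
  moreover have I: "I \<in> Ob C" using hom_Ob[OF em(3)] by simp
  \<comment> \<open>To see that \<open>I\<close> is in \<open>F\<close>: cancelling the epic
    \<open>e\<close> gives \<open>c \<cdot> m = v I\<close>, so \<open>v I\<close> is
    \<open>m\<close> up to isomorphism.\<close>
  obtain c where c: "c \<in> hom C (V A) (V I)" "iso C c" "c \<cdot> v A = v I \<cdot> e"
    using V_iso[OF em(3)] .
  have "(c \<cdot> m) \<cdot> e = v I \<cdot> e" using assoc[OF em(3,4) c(1)] em(5) c(3) by simp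
  then have "c \<cdot> m = v I"
    using E_epic[OF em(1,3) comp_hom[OF em(4) c(1)] v_hom[OF I]] by simp
  then have "c \<cdot> m = v I \<cdot> ident C I" using comp_ident[OF v_hom[OF I]] by simp
  then have "v I \<in> M"
    using replete_arrowsD[OF replete_M em(2,4) v_hom[OF I] ident_hom[OF I] c(1) iso_ident[OF I] c(2)]
    by simp
  then have "I \<in> F" using I unfolding F_def by simp
  ultimately show ?thesis
    using E_zkernel_T[OF em(1,3) k] homD[OF em(3)] homD[OF zkernel_hom(1)[OF k em(3)]]
    unfolding torsion_sequence_def by blast
qed

theorem torsion_theory: "torsion_theory C Z T F"
  unfolding torsion_theory_def
  using replete_T replete_F T_Int_F T_to_F_null torsion_sequence_exists by blast

section \<open>Condition (N)\<close>

theorem condition_N: "condition_N C Z T F"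
  unfolding condition_N_def
proof (intro allI impI)
  fix f k t h
  assume k: "zkernel C Z f k" and ts: "torsion_sequence C Z T F (Dom C k) t h"
  have f: "f \<in> hom C (Dom C f) (Cod C f)" using k hom_self unfolding zkernel_def by blast
  note kh = zkernel_hom[OF k f]
  have h: "h \<in> hom C (Dom C k) (Cod C h)" and t: "zkernel C Z h t"
    and tT: "Dom C t \<in> T" and hF: "Cod C h \<in> F"
    using ts by (auto simp: torsion_sequence_def short_exact_def zkernel_def hom_def)
  have th: "t \<in> hom C (Dom C t) (Dom C k)" using zkernel_hom[OF t h] by simp
  obtain e m I where em: "e \<in> E" "m \<in> M" "e \<in> hom C (Dom C f) I" "m \<in> hom C I (Cod C f)"
      "f = m \<cdot> e"
    using factor[OF f] .
  note kt = comp_hom[OF th kh(1)]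
  have "zkernel C Z e (k \<cdot> t)"
  proof (rule zkernelI[OF em(3) kt])
    \<comment> \<open>The domain of \<open>t\<close> is in \<open>T\<close>, so \<open>m\<close> can
      be cancelled from the null composite.\<close>
    have "null ((f \<cdot> k) \<cdot> t)"
      using null_comp_right[OF kh(2) comp_hom[OF kh(1) f] th] .
    then have "null (m \<cdot> (e \<cdot> (k \<cdot> t)))"
      using assoc[OF th kh(1) f] assoc[OF kt em(3,4)] em(5) by simp
    then show "null (e \<cdot> (k \<cdot> t))"
      using M_reflects_null[OF tT em(2,4) comp_hom[OF kt em(3)]] by simp
  next
    fix X x assume x: "x \<in> hom C X (Dom C f)" and n: "null (e \<cdot> x)"
    \<comment> \<open>It suffices to factor the kernel \<open>s\<close> of \<open>e\<close>. It
      factors through \<open>k\<close> because \<open>f \<cdot> s\<close> is null, and then through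
      \<open>t\<close> because its domain is in \<open>T\<close> and arrows from \<open>T\<close> to
      \<open>F\<close> are null.\<close>
    obtain s where s: "zkernel C Z e s" using zkernel_exists[OF em(3)] .
    note sh = zkernel_hom[OF s em(3)]
    obtain w where w: "w \<in> hom C X (Dom C s)" "s \<cdot> w = x"
      using zkernel_factor[OF s em(3) x n] .
    have "null (f \<cdot> s)"
      using null_comp_left[OF sh(2) comp_hom[OF sh(1) em(3)] em(4)] assoc[OF sh(1) em(3,4)] em(5)
      by simp
    then obtain s' where s': "s' \<in> hom C (Dom C s) (Dom C k)" "k \<cdot> s' = s"
      using zkernel_factor[OF k f sh(1)] by blast
    have "null (h \<cdot> s')"
      using T_to_F_null[OF E_zkernel_T[OF em(1,3) s] hF comp_hom[OF s'(1) h]] .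
    then obtain u where u: "u \<in> hom C (Dom C s) (Dom C t)" "t \<cdot> u = s'"
      using zkernel_factor[OF t h s'(1)] by blast
    have "(k \<cdot> t) \<cdot> u = s" using assoc[OF u(1) th kh(1)] u(2) s'(2) by simp
    then have "(k \<cdot> t) \<cdot> (u \<cdot> w) = x" using assoc[OF w(1) u(1) kt] w(2) by simp
    then show "\<exists>u \<in> hom C X (Dom C t). (k \<cdot> t) \<cdot> u = x"
      using comp_hom[OF w(1) u(1)] by blast
  next
    fix X u w
    assume u: "u \<in> hom C X (Dom C t)" and w: "w \<in> hom C X (Dom C t)"
      and eq: "(k \<cdot> t) \<cdot> u = (k \<cdot> t) \<cdot> w"
    have "k \<cdot> (t \<cdot> u) = k \<cdot> (t \<cdot> w)"
      using assoc[OF u th kh(1)] assoc[OF w th kh(1)] eq by simp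
    then have "t \<cdot> u = t \<cdot> w"
      using zkernel_unique[OF k f comp_hom[OF u th] comp_hom[OF w th]] by simp
    then show "u = w" using zkernel_unique[OF t h u w] by simp
  qed
  then show "\<exists>g. zkernel C Z g (k \<cdot> t)" by blast
qed

section \<open>Condition (M)\<close>

lemma zcokernel_from_T_in_E:
  assumes q: "zcokernel C Z k q" "q \<in> hom C A Q" and k: "k \<in> hom C K A" "K \<in> T"
  shows "q \<in> E"
proof -
  obtain e m I where em: "e \<in> E" "m \<in> M" "e \<in> hom C A I" "m \<in> hom C I Q" "q = m \<cdot> e"
    using factor[OF q(2)] .
  have Ob: "A \<in> Ob C" "I \<in> Ob C" "Q \<in> Ob C" using hom_Ob[OF em(3)] hom_Ob[OF em(4)] by auto
  \<comment> \<open>The goal is that \<open>m\<close> is invertible. Its inverse \<open>n\<close>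
    comes from the cokernel property of \<open>q\<close>, once \<open>e \<cdot> k\<close> is known
    to be null.\<close>
  have "null (m \<cdot> (e \<cdot> k))"
    using zcokernel_hom(2)[OF q(1) k(1)] assoc[OF k(1) em(3,4)] em(5) by simp
  then have "null (e \<cdot> k)"
    using M_reflects_null[OF k(2) em(2,4) comp_hom[OF k(1) em(3)]] by simp
  then obtain n where n: "n \<in> hom C Q I" "n \<cdot> q = e"
    using zcokernel_factor[OF q(1) k(1) em(3)] homD[OF q(2)] by metis
  have "(m \<cdot> n) \<cdot> q = ident C Q \<cdot> q"
    using assoc[OF q(2) n(1) em(4)] n(2) em(5) ident_comp[OF q(2)] by simp
  then have mn: "m \<cdot> n = ident C Q"
    using zcokernel_epic[OF q comp_hom[OF n(1) em(4)] ident_hom[OF Ob(3)]] by simp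
  have "(n \<cdot> m) \<cdot> e = ident C I \<cdot> e"
    using assoc[OF em(3,4) n(1)] n(2) em(5) ident_comp[OF em(3)] by simp
  then have nm: "n \<cdot> m = ident C I"
    using E_epic[OF em(1,3) comp_hom[OF em(4) n(1)] ident_hom[OF Ob(2)]] by simp
  have "m \<cdot> e = q \<cdot> ident C A" using em(5) comp_ident[OF q(2)] by simp
  then show ?thesis
    using replete_arrowsD[OF replete_E em(1,3) q(2) ident_hom[OF Ob(1)] em(4) iso_ident[OF Ob(1)]
        isoI[OF em(4) n(1) nm mn]] by simp
qed

theorem condition_M: "condition_M C Z Zo T F"
  unfolding condition_M_def
proof (intro allI impI)
  fix k q t h
  assume kq: "short_exact C Z k q" and kT: "Dom C k \<in> T"
    and ts: "torsion_sequence C Z T F (Dom C k) t h"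
  let ?K = "Dom C k" and ?H = "Cod C h"
  have k: "zkernel C Z q k" and q: "zcokernel C Z k q" using kq by (auto simp: short_exact_def)
  have qh: "q \<in> hom C (Dom C q) (Cod C q)" using k hom_self unfolding zkernel_def by blast
  note kh = zkernel_hom[OF k qh]
  have Q: "Cod C q \<in> Ob C" using hom_Ob[OF qh] by simp
  have ht: "zcokernel C Z t h" and tK: "Cod C t = ?K" and hF: "?H \<in> F"
    using ts by (simp_all add: torsion_sequence_def short_exact_def)
  have t: "t \<in> hom C (Dom C t) ?K"
    using ht hom_self unfolding zcokernel_def tK[symmetric] by blast
  note h = zcokernel_hom(1)[OF ht t]
  obtain r where r: "r \<in> E" "r \<in> hom C ?K (Zo (Cod C q))"
    using E_zkernel[OF zcokernel_from_T_in_E[OF q qh kh(1) kT] qh k] .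
  note ZQ = Zo_Z[OF Q]
  \<comment> \<open>The arrows \<open>h\<close> and \<open>r\<close> factor through each other:
    \<open>h\<close> through \<open>r\<close> because it ends in \<open>F\<close>, and
    \<open>r\<close> through \<open>h\<close> because \<open>r\<close> ends at a zero object and
    \<open>h\<close> is a cokernel of \<open>t\<close>.\<close>
  obtain d where d: "d \<in> hom C (Zo (Cod C q)) ?H" "d \<cdot> r = h"
    using E_to_Z_factor[OF r ZQ hF h] .
  have "null (r \<cdot> t)" using null_to_Z[OF ZQ comp_hom[OF t r(2)]] .
  then obtain u where u: "u \<in> hom C ?H (Zo (Cod C q))" "u \<cdot> h = r"
    using zcokernel_factor[OF ht t r(2)] by blast
  have H: "?H \<in> Ob C" using hom_Ob[OF h] by simp
  \<comment> \<open>One composite is an identity since \<open>h\<close> is epic, the other by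
    posetality.\<close>
  have "(d \<cdot> u) \<cdot> h = ident C ?H \<cdot> h"
    using assoc[OF h u(1) d(1)] u(2) d(2) ident_comp[OF h] by simp
  then have "d \<cdot> u = ident C ?H"
    using zcokernel_epic[OF ht h comp_hom[OF u(1) d(1)] ident_hom[OF H]] by simp
  moreover have "u \<cdot> d = ident C (Zo (Cod C q))"
    using posetal[OF ZQ ZQ comp_hom[OF d(1) u(1)] ident_hom[OF Z_Ob[OF ZQ]]] .
  ultimately show "isomorphic C ?H (Zo (Cod C q))"
    using isomorphicI[OF u(1) isoI[OF u(1) d(1)]] by blast
qed

end

theorem proposition3p10:
  fixes C :: "('o, 'a) cat"
    and Z T F :: "'o set"
    and Zo V :: "'o \<Rightarrow> 'o"
    and Za :: "'a \<Rightarrow> 'a"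
    and eps v :: "'o \<Rightarrow> 'a"
    and E M :: "'a set"
  assumes "regular_category C"
    and "zero_object_class C Z Zo Za eps"
    and "terminal_class C Z V v"
    and "factorization_system C E M"
    and "stable_along C E (inverted C Za)"
    and "\<forall>e \<in> E. \<exists>f. zcokernel C Z f e"
    and "T = {A \<in> Ob C. \<exists>X \<in> Z. \<exists>e \<in> hom C A X. e \<in> E}"
    and "F = {A \<in> Ob C. v A \<in> M}"
  shows "torsion_theory C Z T F \<and> condition_N C Z T F \<and> condition_M C Z Zo T F"
proof -
  \<comment> \<open>Finite completeness of the regular category supplies the pullbacks.\<close>
  interpret zero_factorization C Z Zo Za eps V v E M T F
    using assms by unfold_locales (auto simp: regular_category_def finitely_complete_def)
  show ?thesis using torsion_theory condition_N condition_M by blast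
qed

end
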